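(* Let $n \in \mathbb{N}$, $a \in \mathbb{R}$, and let $f$ be an arbitrary differentiable function (for which the fractional derivatives below exist). Then \[ (\partial_x)^{a}\,[x^{n} f(x)] = \sum_{m=0}^{n} \binom{n}{m}\,(a)_{m}\, f^{(a-m)}(x)\, x^{n-m}. \]
   Context: $(a)_m = a(a-1)\cdots(a-m+1)$ is the falling factorial, $(a)_0=1$, and $\binom{a}{m}=(a)_m/m!$. For $a\in\mathbb{R}$, $(\partial_x)^a$ denotes fractional differentiation of order $a$ with respect to $x$, and $f^{(a)}=(\partial_x)^a f$. Here fractional differentiation means a family of linear operators $(\partial_x)^a$, $a\in\mathbb{R}$, which agree with the ordinary derivative of order $a$ when $a$ is a nonnegative integer and which obey the extension of the general Leibniz rule to non-integer orders: for a polynomial $p$ and a function $f$ for which the terms exist, \[ (\partial_x)^a[p(x)f(x)] = \sum_{m=0}^{\infty}\binom{a}{m}\,(\partial_x)^{a-m}[f(x)]\;p^{(m)}(x). \] *)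

theory Defs
  imports "HOL-Analysis.Analysis" "HOL-Computational_Algebra.Polynomial"
begin

definition falling_fact :: "real \<Rightarrow> nat \<Rightarrow> real" where
  "falling_fact a m = (\<Prod>i<m. a - real i)"

definition times_differentiable_on ::
    "nat \<Rightarrow> ('a::real_normed_field \<Rightarrow> 'a) \<Rightarrow> 'a set \<Rightarrow> bool" where
  "times_differentiable_on k f S \<longleftrightarrow> (\<forall>j<k. \<forall>x\<in>S. (deriv ^^ j) f field_differentiable (at x))"

text \<open>
  A family of fractional derivatives for functions on an open set \<open>S\<close> (of real or complex
  numbers, say). Functions are total in HOL, so existence is tracked separately:
  \<open>f \<in> E a\<close> means that the derivative of order \<open>a\<close> of \<open>f\<close> exists on \<open>S\<close>, and only then
  is \<open>D a f\<close> meaningful, and only at points of \<open>S\<close>.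

  In \<open>leibniz\<close> the terms of index \<open>m > degree p\<close> vanish because the corresponding
  derivative of \<open>p\<close> is zero, so the existence of \<open>D (a - real m) f\<close> is only demanded for
  \<open>m \<le> degree p\<close>.
\<close>

locale fractional_differentiation =
  fixes S :: "'a::real_normed_field set"
    and E :: "real \<Rightarrow> ('a \<Rightarrow> 'a) set"
    and D :: "real \<Rightarrow> ('a \<Rightarrow> 'a) \<Rightarrow> 'a \<Rightarrow> 'a"
  assumes open_domain: "open S"
    and zero_mem: "(\<lambda>_. 0) \<in> E a"
    and linear_mem: "f \<in> E a \<Longrightarrow> g \<in> E a \<Longrightarrow> (\<lambda>x. c * f x + d * g x) \<in> E a"
    and linear: "f \<in> E a \<Longrightarrow> g \<in> E a \<Longrightarrow> x \<in> S \<Longrightarrow>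
      D a (\<lambda>x. c * f x + d * g x) x = c * D a f x + d * D a g x"
    and ordinary_mem: "times_differentiable_on k f S \<Longrightarrow> f \<in> E (real k)"
    and ordinary: "times_differentiable_on k f S \<Longrightarrow> x \<in> S \<Longrightarrow>
      D (real k) f x = (deriv ^^ k) f x"
    and leibniz: "(\<lambda>x. poly p x * f x) \<in> E a \<Longrightarrow> (\<forall>m\<le>degree p. f \<in> E (a - real m)) \<Longrightarrow> x \<in> S \<Longrightarrow>
      (\<lambda>m. of_real (a gchoose m) * D (a - real m) f x * poly ((pderiv ^^ m) p) x)
        sums D a (\<lambda>x. poly p x * f x) x"

end

theory Submission
  imports Defs
begin

text \<open>
  The Leibniz rule is applied to \<open>p = monom 1 n\<close>. The factor \<open>m!\<close> of the \<open>m\<close>-th derivative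
  \<open>m! (n choose m) x^(n-m)\<close> of \<open>p\<close> cancels the denominator of \<open>a gchoose m\<close>.
\<close>

text \<open>Expand \<open>Suc n choose Suc m\<close> by Pascal's rule in the absorption identity and
  cancel \<open>Suc m * (n choose m)\<close>. For \<open>m > n\<close> both binomials
  vanish.\<close>

lemma Suc_times_binomial_Suc: "Suc m * (n choose Suc m) = (n - m) * (n choose m)"
proof (cases "m \<le> n")
  case True
  then obtain d where "n = m + d"
    using le_Suc_ex by blast
  then show ?thesis
    using Suc_times_binomial[of m n] by (simp add: algebra_simps)
qed (simp add: binomial_eq_0)

text \<open>No bound on \<open>m\<close> is needed: for \<open>m > n\<close> the coefficient is
  zero, so the truncated exponent \<open>n - m\<close> is harmless.\<close>

lemma higher_pderiv_monom_binomial: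
  "(pderiv ^^ m) (monom 1 n :: 'a::idom poly) = monom (of_nat (fact m * (n choose m))) (n - m)"
proof (induction m)
  case (Suc m)
  have "(n - m) * (fact m * (n choose m)) = fact (Suc m) * (n choose Suc m)"
    using arg_cong[OF Suc_times_binomial_Suc[of m n], of "\<lambda>k. fact m * k"]
    by (simp add: algebra_simps)
  then show ?case
    by (simp add: Suc.IH pderiv_monom del: fact_Suc of_nat_mult flip: of_nat_mult)
qed simp

lemma gbinomial_times_fact: "(a gchoose m) * fact m = falling_fact a m"
  by (simp add: gbinomial_prod_rev falling_fact_def atLeast0LessThan)

theorem theorem2p2:
  fixes S :: "'a::real_normed_field set"
    and E :: "real \<Rightarrow> ('a \<Rightarrow> 'a) set"
    and D :: "real \<Rightarrow> ('a \<Rightarrow> 'a) \<Rightarrow> 'a \<Rightarrow> 'a"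
    and n :: nat and a :: real and f :: "'a \<Rightarrow> 'a" and x :: 'a
  assumes "fractional_differentiation S E D"
    and "\<forall>y\<in>S. f field_differentiable (at y)"
    and "(\<lambda>y. y ^ n * f y) \<in> E a"
    and "\<forall>m\<le>n. f \<in> E (a - real m)"
    and "x \<in> S"
  shows "D a (\<lambda>y. y ^ n * f y) x =
    (\<Sum>m=0..n. of_nat (n choose m) * of_real (falling_fact a m) * D (a - real m) f x * x ^ (n - m))"
proof -
  interpret fractional_differentiation S E D by fact
  let ?p = "monom 1 n :: 'a poly"
  let ?t = "\<lambda>m. of_real (a gchoose m) * D (a - real m) f x * poly ((pderiv ^^ m) ?p) x"
  have t: "?t m = of_nat (n choose m) * of_real (falling_fact a m) * D (a - real m) f x * x ^ (n - m)"
    for m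
    by (simp add: higher_pderiv_monom_binomial poly_monom flip: gbinomial_times_fact)
  have "?t sums D a (\<lambda>y. poly ?p y * f y) x"
    \<comment> \<open>\<open>?p\<close> has degree exactly \<open>n\<close>, so the existence
      premise of \<open>leibniz\<close> is the assumption on orders \<open>a - m\<close> with
      \<open>m \<le> n\<close>.\<close>
    using assms(3-5) by (intro leibniz) (simp_all add: poly_monom degree_monom_eq)
  moreover have "?t sums (\<Sum>m=0..n. ?t m)"
    \<comment> \<open>By \<open>t\<close>, the factor \<open>n choose m\<close> kills every term
      with \<open>m > n\<close>.\<close>
    by (rule sums_finite) (auto simp: t)
  ultimately have "D a (\<lambda>y. poly ?p y * f y) x = (\<Sum>m=0..n. ?t m)"
    by (rule sums_unique2)
  then show ?thesis
    unfolding t by (simp add: poly_monom)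
qed

end
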